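(* Let $n,d\ge 1$, let $S$ be a fine mixed subdivision of $n\Delta_{d-1}$, and let $\sigma(S)$ be the corresponding system of permutations on the edges of $n\Delta_{d-1}$. Then $\sigma(S)$ is acyclic.
   Context: Notation: $[m]=\{1,\dots,m\}$. $\Delta_{d-1}$ is the convex hull of the standard basis vectors $w_1,\dots,w_d$ of $\mathbb R^d$, and $n\Delta_{d-1}$ is its dilation by $n$, with vertices $nw_1,\dots,nw_d$. A (nonempty) face of $\Delta_{d-1}$ is identified with its set of vertices; $w_aw_b$ denotes the edge with vertices $w_a,w_b$. Fine mixed subdivisions: a fine mixed cell is a Minkowski sum $B_1+\cdots+B_n$ of nonempty faces $B_i$ of $\Delta_{d-1}$ which lie in independent affine subspaces (i.e. $\dim(B_1+\cdots+B_n)=\sum_i\dim B_i$) and whose dimensions add up to $d-1$. A fine mixed subdivision $S$ of $n\Delta_{d-1}$ is a polyhedral subdivision of $n\Delta_{d-1}$ into fine mixed cells such that the intersection of any two cells is a face of both. Its cells (of all dimensions) are labeled by ordered Minkowski sums $S_1+\cdots+S_n$ of nonempty faces of $\Delta_{d-1}$ in such a way that if $B_1+\cdots+B_n$ is a face of $C_1+\cdots+C_n$ then $B_i$ is a face of $C_i$ for each $i$; such a labeling always exists and is fixed as part of the data of $S$. System of permutations of a subdivision: for $a\ne b$ in $[d]$ and $r\in[n]$ there is a unique cell of $S$ having $r-1$ summands equal to $w_b$, $n-r$ summands equal to $w_a$ and one summand equal to $w_aw_b$; let $\sigma_{ab}(r)\in[n]$ be the index of the summand equal to $w_aw_b$.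 Then $\sigma_{ab}$ is a permutation of $[n]$ (written in one-line notation as the word $\sigma_{ab}(1)\cdots\sigma_{ab}(n)$), and $\sigma(S)=(\sigma_{ab})_{1\le a\ne b\le d}$. Systems of permutations: a system of permutations on the edges of $n\Delta_{d-1}$ is a collection $\sigma=(\sigma_{ab})_{1\le a\neq b\le d}$ of permutations of $[n]$ such that the word $\sigma_{ab}$ is the reverse of the word $\sigma_{ba}$ for all $a\ne b$. For $i\ne j$ in $[n]$, $G_{ij}(\sigma)$ is the directed complete graph on $[d]$ in which the edge $ab$ is directed $a\to b$ if and only if $i$ appears before $j$ in the word $\sigma_{ab}$. The system $\sigma$ is acyclic if all graphs $G_{ij}(\sigma)$ have no directed cycle. *)

theory Defs
  imports "HOL-Analysis.Analysis" "HOL-Combinatorics.Permutations"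
begin

text \<open>The index set \<open>[d]\<close> is a finite type \<open>'d\<close>, so \<open>\<real>\<^sup>d\<close> is \<open>real ^ 'd\<close> and \<open>d = CARD('d) \<ge> 1\<close>.
  The summand indices \<open>[n]\<close> are \<open>{1..n} :: nat set\<close>.\<close>

definition simplex_face :: "'d::finite set \<Rightarrow> (real ^ 'd) set" where
  "simplex_face A = convex hull ((\<lambda>a. axis a 1) ` A)"

definition dilated_simplex :: "nat \<Rightarrow> (real ^ 'd::finite) set" where
  "dilated_simplex n = (\<lambda>x. real n *\<^sub>R x) ` simplex_face UNIV"

text \<open>An ordered sequence of nonempty faces of the simplex is a function \<open>B :: nat \<Rightarrow> 'd set\<close>, of which
  only the values on \<open>{1..n}\<close> matter; each face is given by its vertex set.\<close>

definition face_sequence :: "nat \<Rightarrow> (nat \<Rightarrow> 'd::finite set) \<Rightarrow> bool" where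
  "face_sequence n B \<longleftrightarrow> (\<forall>i\<in>{1..n}. B i \<noteq> {})"

text \<open>The sum below is the Minkowski sum of sets from \<open>HOL-Library.Set_Algebras\<close>.\<close>

definition mixed_cell :: "nat \<Rightarrow> (nat \<Rightarrow> 'd::finite set) \<Rightarrow> (real ^ 'd) set" where
  "mixed_cell n B = (\<Sum>i\<in>{1..n}. simplex_face (B i))"

definition fine_label :: "nat \<Rightarrow> (nat \<Rightarrow> 'd::finite set) \<Rightarrow> bool" where
  "fine_label n B \<longleftrightarrow>
     face_sequence n B \<and>
     aff_dim (mixed_cell n B) = (\<Sum>i\<in>{1..n}. aff_dim (simplex_face (B i))) \<and>
     (\<Sum>i\<in>{1..n}. aff_dim (simplex_face (B i))) = int CARD('d) - 1"

text \<open>A subdivision is given by the set \<open>T\<close> of its maximal cells and a labeling \<open>lab\<close> of all its cells,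
  i.e. of the nonempty faces of the members of \<open>T\<close>.\<close>

definition cells :: "(real ^ 'd::finite) set set \<Rightarrow> (real ^ 'd) set set" where
  "cells T = {F. F \<noteq> {} \<and> (\<exists>C\<in>T. F face_of C)}"

definition fine_mixed_subdivision ::
  "nat \<Rightarrow> (real ^ 'd::finite) set set \<Rightarrow> ((real ^ 'd) set \<Rightarrow> nat \<Rightarrow> 'd set) \<Rightarrow> bool" where
  "fine_mixed_subdivision n T lab \<longleftrightarrow>
     \<Union>T = dilated_simplex n \<and>
     (\<forall>C\<in>T. \<forall>D\<in>T. (C \<inter> D) face_of C \<and> (C \<inter> D) face_of D) \<and>
     (\<forall>C\<in>T. fine_label n (lab C)) \<and>
     (\<forall>F\<in>cells T. face_sequence n (lab F) \<and> F = mixed_cell n (lab F)) \<and>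
     (\<forall>F\<in>cells T. \<forall>G\<in>cells T. F face_of G \<longrightarrow> (\<forall>i\<in>{1..n}. lab F i \<subseteq> lab G i))"

definition edge_cell ::
  "nat \<Rightarrow> (real ^ 'd::finite) set set \<Rightarrow> ((real ^ 'd) set \<Rightarrow> nat \<Rightarrow> 'd set) \<Rightarrow>
    'd \<Rightarrow> 'd \<Rightarrow> nat \<Rightarrow> (real ^ 'd) set" where
  "edge_cell n T lab a b r =
     (THE F. F \<in> cells T \<and>
        card {i\<in>{1..n}. lab F i = {b}} = r - 1 \<and>
        card {i\<in>{1..n}. lab F i = {a}} = n - r \<and>
        card {i\<in>{1..n}. lab F i = {a, b}} = 1)"

text \<open>Words are functions on positions \<open>{1..n}\<close>, extended by the identity so as to fit \<open>permutes\<close>.\<close>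

definition subdivision_perm ::
  "nat \<Rightarrow> (real ^ 'd::finite) set set \<Rightarrow> ((real ^ 'd) set \<Rightarrow> nat \<Rightarrow> 'd set) \<Rightarrow>
    'd \<Rightarrow> 'd \<Rightarrow> nat \<Rightarrow> nat" where
  "subdivision_perm n T lab a b r =
     (if r \<in> {1..n} then THE i. i \<in> {1..n} \<and> lab (edge_cell n T lab a b r) i = {a, b} else r)"

definition system_of_permutations :: "nat \<Rightarrow> ('d \<Rightarrow> 'd \<Rightarrow> nat \<Rightarrow> nat) \<Rightarrow> bool" where
  "system_of_permutations n \<sigma> \<longleftrightarrow>
     (\<forall>a b. a \<noteq> b \<longrightarrow>
        \<sigma> a b permutes {1..n} \<and> (\<forall>r\<in>{1..n}. \<sigma> a b r = \<sigma> b a (n + 1 - r)))"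

definition appears_before :: "nat \<Rightarrow> (nat \<Rightarrow> nat) \<Rightarrow> nat \<Rightarrow> nat \<Rightarrow> bool" where
  "appears_before n w i j \<longleftrightarrow> (\<exists>r\<in>{1..n}. \<exists>s\<in>{1..n}. r < s \<and> w r = i \<and> w s = j)"

definition edge_digraph ::
  "nat \<Rightarrow> ('d \<Rightarrow> 'd \<Rightarrow> nat \<Rightarrow> nat) \<Rightarrow> nat \<Rightarrow> nat \<Rightarrow> ('d \<times> 'd) set" where
  "edge_digraph n \<sigma> i j = {(a, b). a \<noteq> b \<and> appears_before n (\<sigma> a b) i j}"

text \<open>Acyclicity is a property of systems of permutations, so being one is part of the predicate.\<close>

definition acyclic_system :: "nat \<Rightarrow> ('d \<Rightarrow> 'd \<Rightarrow> nat \<Rightarrow> nat) \<Rightarrow> bool" where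
  "acyclic_system n \<sigma> \<longleftrightarrow>
     system_of_permutations n \<sigma> \<and>
     (\<forall>i\<in>{1..n}. \<forall>j\<in>{1..n}. i \<noteq> j \<longrightarrow> acyclic (edge_digraph n \<sigma> i j))"

end

theory Submission imports Defs begin

text \<open>A point of the dilated simplex lies in a cell \<open>C\<^sub>1 + \<dots> + C\<^sub>n\<close>, and by independence it decomposes in only one way
  as a sum of points of the \<open>C\<^sub>i\<close>. Hence the faces of the cell correspond to the sequences of nonempty faces
  of the \<open>C\<^sub>i\<close>, and replacing summands of a cell by smaller ones yields cells again. So it suffices to work
  with the set of occurring labels, which is closed under shrinking (\<open>occurs_subface\<close>).

The engine is a way to walk through the subdivision (\<open>push_towards\<close>). Let \<open>A\<close> be a set of vertices and \<open>B\<close> an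
  occurring label each of whose summands lies in \<open>A\<close> or avoids \<open>A\<close>, the latter for at least one summand. On the cell of \<open>B\<close> the sum of the
  coordinates in \<open>A\<close> is then constant, namely the number of summands inside \<open>A\<close>. Moving a little from an
  interior point of the cell towards a vertex of \<open>A\<close> increases this sum, so the adjacent cell entered must have
  a summand that meets \<open>A\<close> where the summand of \<open>B\<close> avoids it: that summand can be enlarged by an element of \<open>A\<close>.

Two walks are needed. Walking towards one new vertex \<open>c\<close> at a time, the \<open>i\<close>-th summand grows to any prescribed
  face while all others stay vertices (\<open>occurs_with_full_summand\<close>): each step either adds \<open>c\<close> to the \<open>i\<close>-th summand
  or turns another summand into \<open>c\<close>, which happens at most \<open>n\<close> times. Walking towards a face \<open>A\<close>, all summands
  avoiding \<open>A\<close> become vertices of \<open>A\<close>, and the summands inside \<open>A\<close> never change (\<open>occurs_retract\<close>).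

The edge between two vertices \<open>a\<close> and \<open>b\<close> is cut into \<open>n\<close> unit segments. Consecutive segments share a vertex, so
  the summands equal to \<open>b\<close> in the \<open>r\<close>-th one are exactly the first \<open>r - 1\<close> letters of \<open>\<sigma>\<^bsub>ab\<^esub>\<close>. Every index occurs as a
  letter, because a cell whose \<open>i\<close>-th summand is \<open>{a, b}\<close> retracts onto the edge.

For acyclicity of \<open>G\<^bsub>ij\<^esub>\<close>, let \<open>Q\<close> be a nonempty set of vertices; a member without predecessor in \<open>Q\<close> is wanted.
  Take a cell whose \<open>i\<close>-th summand is \<open>Q\<close> and whose \<open>j\<close>-th summand is a vertex \<open>p \<in> Q\<close>. For another \<open>q \<in> Q\<close>, shrink the
  \<open>i\<close>-th summand to \<open>{q, p}\<close> and retract onto the edge \<open>qp\<close>: the \<open>j\<close>-th summand stays \<open>p\<close>, so at the moment when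
  \<open>i\<close> travels from \<open>q\<close> to \<open>p\<close>, \<open>j\<close> has already arrived. Thus \<open>j\<close> precedes \<open>i\<close> in \<open>\<sigma>\<^bsub>qp\<^esub>\<close>, and there is no arrow
  from \<open>q\<close> to \<open>p\<close>. Hence \<open>p\<close> is the member sought.\<close>

section \<open>Faces of the simplex and their Minkowski sums\<close>

lemma mem_simplex_face:
  "v \<in> simplex_face B \<longleftrightarrow>
     (\<forall>a. 0 \<le> v $ a) \<and> (\<forall>a. a \<notin> B \<longrightarrow> v $ a = 0) \<and> (\<Sum>a\<in>UNIV. v $ a) = 1"
  (is "?L \<longleftrightarrow> ?R v")
proof
  assume ?L
  moreover have "convex hull ((\<lambda>a. axis a 1) ` B) \<subseteq> {v. ?R v}"
  proof (rule hull_minimal)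
    show "(\<lambda>a. axis a 1) ` B \<subseteq> {v. ?R v}"
      by (auto simp: axis_def)
    show "convex {v. ?R v}"
      by (auto simp: convex_def sum.distrib simp flip: sum_distrib_left)
  qed
  ultimately show "?R v" by (auto simp: simplex_face_def)
next
  assume R: "?R v"
  have 1: "(\<Sum>a\<in>B. v $ a) = 1"
    using R by (metis (no_types, lifting) Diff_iff UNIV_I finite_code subset_UNIV sum.mono_neutral_left)
  have "v = (\<Sum>a\<in>UNIV. (v $ a) *\<^sub>R axis a 1)"
    by (simp add: vec_eq_iff axis_def if_distrib sum.delta cong: if_cong)
  also have "\<dots> = (\<Sum>a\<in>B. (v $ a) *\<^sub>R axis a 1)"
    using R by (intro sum.mono_neutral_right) auto
  also have "\<dots> \<in> convex hull ((\<lambda>a. axis a 1) ` B)"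
    using R 1 by (intro convex_sum) (auto intro: hull_inc)
  finally show ?L by (simp add: simplex_face_def)
qed

lemma simplex_face_mono: "A \<subseteq> B \<Longrightarrow> simplex_face A \<subseteq> simplex_face B"
  unfolding mem_simplex_face subset_iff by blast

lemma axis_in_simplex_face: "a \<in> B \<Longrightarrow> axis a 1 \<in> simplex_face B"
  by (simp add: simplex_face_def hull_inc)

lemma simplex_face_singleton: "simplex_face {a} = {axis a 1}"
  by (simp add: simplex_face_def)

lemma convex_simplex_face: "convex (simplex_face B)"
  by (simp add: simplex_face_def)

lemma simplex_face_face_of: "A \<subseteq> B \<Longrightarrow> simplex_face A face_of simplex_face B"
  unfolding face_of_def
proof (intro conjI ballI impI)
  fix x y z assume AB: "A \<subseteq> B" and x: "x \<in> simplex_face B" and y: "y \<in> simplex_face B"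
    and z: "z \<in> simplex_face A" "z \<in> open_segment x y"
  obtain u where u: "0 < u" "u < 1" "z = (1 - u) *\<^sub>R x + u *\<^sub>R y"
    using z by (auto simp: in_segment)
  have "x $ a = 0 \<and> y $ a = 0" if "a \<notin> A" for a
  proof -
    have "(1 - u) * x $ a + u * y $ a = 0"
      using z(1) that u(3) by (auto simp: mem_simplex_face)
    moreover have "0 \<le> (1 - u) * x $ a" "0 \<le> u * y $ a"
      using x y u by (auto simp: mem_simplex_face)
    ultimately have "(1 - u) * x $ a = 0" "u * y $ a = 0" by linarith+
    then show ?thesis using u by auto
  qed
  then show "x \<in> simplex_face A" "y \<in> simplex_face A"
    using x y by (auto simp: mem_simplex_face)
qed (auto simp: simplex_face_mono convex_simplex_face)

lemma aff_dim_simplex_face: "aff_dim (simplex_face (B :: 'd::finite set)) = int (card B) - 1"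
proof -
  let ?W = "(\<lambda>a. axis a (1::real)) ` B"
  have inj: "inj_on (\<lambda>a. axis a (1::real)) B"
    by (auto simp: inj_on_def axis_eq_axis)
  have "?W \<subseteq> Basis" by auto
  then have "independent ?W"
    by (rule independent_mono[OF independent_Basis])
  then have "\<not> affine_dependent ?W"
    using affine_dependent_imp_dependent by blast
  then have "int (card ?W) = aff_dim ?W + 1"
    using aff_dim_affine_independent by fastforce
  then show ?thesis
    using card_image[OF inj] by (simp add: simplex_face_def aff_dim_convex_hull)
qed

lemma mem_mixed_cell:
  "v \<in> mixed_cell n B \<longleftrightarrow>
     (\<exists>x. (\<forall>i\<in>{1..n}. x i \<in> simplex_face (B i)) \<and> v = (\<Sum>i\<in>{1..n}. x i))"
  unfolding mixed_cell_def by (subst set_sum_alt) auto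

lemma sum_in_mixed_cell:
  "(\<And>i. i \<in> {1..n} \<Longrightarrow> x i \<in> simplex_face (B i)) \<Longrightarrow> (\<Sum>i\<in>{1..n}. x i) \<in> mixed_cell n B"
  unfolding mem_mixed_cell by blast

lemma mixed_cell_cong: "(\<And>i. i \<in> {1..n} \<Longrightarrow> A i = B i) \<Longrightarrow> mixed_cell n A = mixed_cell n B"
  unfolding mixed_cell_def by (intro sum.cong) auto

lemma mixed_cell_mono:
  assumes "\<And>i. i \<in> {1..n} \<Longrightarrow> A i \<subseteq> B i"
  shows "mixed_cell n A \<subseteq> mixed_cell n B"
proof
  fix v assume "v \<in> mixed_cell n A"
  then obtain x where "\<forall>i\<in>{1..n}. x i \<in> simplex_face (A i)" "v = (\<Sum>i\<in>{1..n}. x i)"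
    unfolding mem_mixed_cell by blast
  moreover have "\<forall>i\<in>{1..n}. simplex_face (A i) \<subseteq> simplex_face (B i)"
    using assms by (simp add: simplex_face_mono)
  ultimately show "v \<in> mixed_cell n B"
    unfolding mem_mixed_cell by blast
qed

lemma convex_mixed_cell: "convex (mixed_cell n B)"
  unfolding mixed_cell_def by (intro convex_set_sum convex_simplex_face)

lemma closed_mixed_cell: "closed (mixed_cell n B)"
proof -
  have "mixed_cell n B = convex hull (\<Sum>i\<in>{1..n}. (\<lambda>a. axis a 1) ` B i)"
    unfolding mixed_cell_def simplex_face_def by (rule convex_hull_set_sum[symmetric])
  moreover have "finite (\<Sum>i\<in>{1..n}. (\<lambda>a. axis a (1::real)) ` B i)"
    by (intro finite_set_sum) auto
  ultimately show ?thesis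
    by (simp add: compact_imp_closed finite_imp_compact_convex_hull)
qed

lemma mixed_cell_nonempty: "face_sequence n B \<Longrightarrow> mixed_cell n B \<noteq> {}"
proof -
  assume "face_sequence n B"
  then have "\<forall>i\<in>{1..n}. \<exists>a. a \<in> B i" by (auto simp: face_sequence_def)
  then obtain c where "\<forall>i\<in>{1..n}. c i \<in> B i" by metis
  then have "(\<Sum>i\<in>{1..n}. axis (c i) 1) \<in> mixed_cell n B"
    by (intro sum_in_mixed_cell axis_in_simplex_face) auto
  then show ?thesis by auto
qed

section \<open>Unique decomposition in independent Minkowski sums\<close>

text \<open>Choosing a base vertex \<open>c i\<close> in each \<open>B i\<close>, the differences of the remaining vertices from it span the direction
  space of the cell. There are as many of them as the dimension of the cell, so they are linearly independent, and
  the coordinates of each summand are the coefficients of these vectors.\<close>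
lemma fine_label_unique_summands:
  fixes B :: "nat \<Rightarrow> 'd::finite set"
  assumes B: "fine_label n B"
    and x: "\<And>i. i \<in> {1..n} \<Longrightarrow> x i \<in> simplex_face (B i)"
    and y: "\<And>i. i \<in> {1..n} \<Longrightarrow> y i \<in> simplex_face (B i)"
    and eq: "(\<Sum>i\<in>{1..n}. x i) = (\<Sum>i\<in>{1..n}. y i)"
    and k: "k \<in> {1..n}"
  shows "x k = y k"
proof -
  have "\<forall>i\<in>{1..n}. \<exists>a. a \<in> B i" using B by (auto simp: fine_label_def face_sequence_def)
  then obtain c where c: "\<And>i. i \<in> {1..n} \<Longrightarrow> c i \<in> B i" by metis
  define I where "I = Sigma {1..n} (\<lambda>i. B i - {c i})"
  define v where "v = (\<lambda>(i, a). axis a 1 - axis (c i) 1 :: real ^ 'd)"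
  have finI: "finite I" by (simp add: I_def)
  have expand: "(\<Sum>a\<in>B i - {c i}. (z $ a) *\<^sub>R v (i, a)) = z - axis (c i) 1"
    if i: "i \<in> {1..n}" and z: "z \<in> simplex_face (B i)" for i z
  proof -
    have all: "(\<Sum>a\<in>B i. z $ a) = 1"
      using z unfolding mem_simplex_face
      by (metis (no_types, lifting) Diff_iff UNIV_I finite_code subset_UNIV sum.mono_neutral_left)
    have "z = (\<Sum>a\<in>UNIV. (z $ a) *\<^sub>R axis a 1)"
      by (simp add: vec_eq_iff axis_def if_distrib sum.delta cong: if_cong)
    also have "\<dots> = (\<Sum>a\<in>B i. (z $ a) *\<^sub>R axis a 1)"
      using z by (intro sum.mono_neutral_right) (auto simp: mem_simplex_face)
    also have "\<dots> = (\<Sum>a\<in>B i. (z $ a) *\<^sub>R axis (c i) 1 + (z $ a) *\<^sub>R v (i, a))"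
      by (simp add: v_def algebra_simps)
    also have "\<dots> = axis (c i) 1 + (\<Sum>a\<in>B i. (z $ a) *\<^sub>R v (i, a))"
      using all by (simp add: sum.distrib flip: scaleR_sum_left)
    also have "(\<Sum>a\<in>B i. (z $ a) *\<^sub>R v (i, a)) = (\<Sum>a\<in>B i - {c i}. (z $ a) *\<^sub>R v (i, a))"
      by (intro sum.mono_neutral_right) (auto simp: v_def)
    finally show ?thesis by (metis add_diff_cancel_left')
  qed
  have cell_sub: "mixed_cell n B \<subseteq> (+) (\<Sum>i\<in>{1..n}. axis (c i) 1) ` span (v ` I)"
  proof
    fix p assume "p \<in> mixed_cell n B"
    then obtain z where z: "\<forall>i\<in>{1..n}. z i \<in> simplex_face (B i)" "p = (\<Sum>i\<in>{1..n}. z i)"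
      unfolding mem_mixed_cell by blast
    have "p = (\<Sum>i\<in>{1..n}. axis (c i) 1 + (\<Sum>a\<in>B i - {c i}. (z i $ a) *\<^sub>R v (i, a)))"
      unfolding z(2) using z(1) by (intro sum.cong) (auto simp: expand)
    moreover have "(\<Sum>i\<in>{1..n}. \<Sum>a\<in>B i - {c i}. (z i $ a) *\<^sub>R v (i, a)) \<in> span (v ` I)"
      by (intro span_sum span_scale span_base imageI) (auto simp: I_def)
    ultimately show "p \<in> (+) (\<Sum>i\<in>{1..n}. axis (c i) 1) ` span (v ` I)"
      by (simp add: sum.distrib)
  qed
  have "int (card I) = (\<Sum>i\<in>{1..n}. int (card (B i - {c i})))"
    by (simp add: I_def card_SigmaI)
  also have "\<dots> = (\<Sum>i\<in>{1..n}. aff_dim (simplex_face (B i)))"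
  proof (intro sum.cong refl)
    fix i assume i: "i \<in> {1..n}"
    then have "card (B i) > 0" using c by (auto simp: card_gt_0_iff)
    then show "int (card (B i - {c i})) = aff_dim (simplex_face (B i))"
      using c[OF i] by (simp add: aff_dim_simplex_face)
  qed
  also have "\<dots> = aff_dim (mixed_cell n B)" using B by (simp add: fine_label_def)
  also have "\<dots> \<le> aff_dim ((+) (\<Sum>i\<in>{1..n}. axis (c i) 1) ` span (v ` I))"
    by (rule aff_dim_subset[OF cell_sub])
  also have "\<dots> = int (dim (v ` I))"
    by (simp add: aff_dim_translation_eq aff_dim_subspace)
  \<comment> \<open>The spanning family \<open>v\<close> has at most \<open>card I\<close> members, so all inequalities become equalities.\<close>
  finally have dimge: "card I \<le> dim (v ` I)" by simp
  also have "dim (v ` I) \<le> card (v ` I)" using finI by (simp add: dim_le_card')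
  finally have cardeq: "card (v ` I) = card I" using card_image_le[OF finI, of v] by simp
  then have inj: "inj_on v I" using finI by (simp add: eq_card_imp_inj_on)
  have indep: "independent (v ` I)"
    using dimge cardeq finI
    by (intro card_le_dim_spanning[of _ "v ` I"]) (auto intro: span_base)
  define f where "f = (\<lambda>(i, a). x i $ a - y i $ a)"
  have "(\<Sum>p\<in>I. f p *\<^sub>R v p)
      = (\<Sum>i\<in>{1..n}. \<Sum>a\<in>B i - {c i}. (x i $ a - y i $ a) *\<^sub>R v (i, a))"
    unfolding I_def by (subst sum.Sigma) (auto simp: f_def intro!: sum.cong)
  also have "\<dots> = (\<Sum>i\<in>{1..n}. x i - y i)"
  proof (intro sum.cong refl)
    fix i assume i: "i \<in> {1..n}"
    show "(\<Sum>a\<in>B i - {c i}. (x i $ a - y i $ a) *\<^sub>R v (i, a)) = x i - y i"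
      using expand[OF i x[OF i]] expand[OF i y[OF i]]
      by (simp add: scaleR_diff_left sum_subtractf)
  qed
  also have "\<dots> = 0" using eq by (simp add: sum_subtractf)
  finally have 0: "(\<Sum>w\<in>v ` I. f (the_inv_into I v w) *\<^sub>R w) = 0"
    by (simp add: sum.reindex[OF inj] the_inv_into_f_f[OF inj])
  have coeff: "x k $ a = y k $ a" if "a \<in> B k - {c k}" for a
  proof -
    have ka: "(k, a) \<in> I" using that k by (simp add: I_def)
    have "f (the_inv_into I v (v (k, a))) = 0"
      using indep finI 0 ka by (intro independentD[of "v ` I" "v ` I"]) auto
    then show ?thesis using ka by (simp add: the_inv_into_f_f[OF inj] f_def)
  qed
  have "(\<Sum>a\<in>B k - {c k}. (x k $ a) *\<^sub>R v (k, a)) = (\<Sum>a\<in>B k - {c k}. (y k $ a) *\<^sub>R v (k, a))"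
    using coeff by (intro sum.cong) auto
  then show ?thesis
    using expand[OF k x[OF k]] expand[OF k y[OF k]] by simp
qed

text \<open>By unique decomposition a segment in the cell splits into segments in the summands, so the face property may be
  checked in each summand.\<close>
lemma mixed_cell_face_of:
  assumes M: "fine_label n M" and BM: "\<And>i. i \<in> {1..n} \<Longrightarrow> B i \<subseteq> M i"
  shows "mixed_cell n B face_of mixed_cell n M"
  unfolding face_of_def
proof (intro conjI ballI impI)
  show "mixed_cell n B \<subseteq> mixed_cell n M" by (rule mixed_cell_mono[OF BM])
  fix p q z assume p: "p \<in> mixed_cell n M" and q: "q \<in> mixed_cell n M"
    and z: "z \<in> mixed_cell n B" and pq: "z \<in> open_segment p q"
  obtain x where x: "\<And>i. i \<in> {1..n} \<Longrightarrow> x i \<in> simplex_face (M i)" "p = (\<Sum>i\<in>{1..n}. x i)"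
    using p unfolding mem_mixed_cell by blast
  obtain y where y: "\<And>i. i \<in> {1..n} \<Longrightarrow> y i \<in> simplex_face (M i)" "q = (\<Sum>i\<in>{1..n}. y i)"
    using q unfolding mem_mixed_cell by blast
  obtain w where w: "\<And>i. i \<in> {1..n} \<Longrightarrow> w i \<in> simplex_face (B i)" "z = (\<Sum>i\<in>{1..n}. w i)"
    using z unfolding mem_mixed_cell by blast
  obtain u where u: "0 < u" "u < 1" "z = (1 - u) *\<^sub>R p + u *\<^sub>R q"
    using pq by (auto simp: in_segment)
  have split: "w k = (1 - u) *\<^sub>R x k + u *\<^sub>R y k" if k: "k \<in> {1..n}" for k
  proof (rule fine_label_unique_summands[OF M _ _ _ k])
    fix i assume i: "i \<in> {1..n}"
    show "w i \<in> simplex_face (M i)" using w(1)[OF i] simplex_face_mono[OF BM[OF i]] by blast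
    show "(1 - u) *\<^sub>R x i + u *\<^sub>R y i \<in> simplex_face (M i)"
      using u x(1)[OF i] y(1)[OF i] by (intro convexD[OF convex_simplex_face]) auto
  next
    show "(\<Sum>i\<in>{1..n}. w i) = (\<Sum>i\<in>{1..n}. (1 - u) *\<^sub>R x i + u *\<^sub>R y i)"
      using u(3) x(2) y(2) w(2) by (simp add: sum.distrib scaleR_sum_right)
  qed
  have "x k \<in> simplex_face (B k) \<and> y k \<in> simplex_face (B k)" if k: "k \<in> {1..n}" for k
  proof (cases "x k = y k")
    case True
    then show ?thesis using split[OF k] w(1)[OF k] by (simp flip: scaleR_left_distrib)
  next
    case False
    then have "w k \<in> open_segment (x k) (y k)"
      using split[OF k] u by (auto simp: in_segment)
    then show ?thesis
      using simplex_face_face_of[OF BM[OF k]] x(1)[OF k] y(1)[OF k] w(1)[OF k]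
      unfolding face_of_def by blast
  qed
  then show "p \<in> mixed_cell n B" "q \<in> mixed_cell n B"
    unfolding x(2) y(2) by (blast intro: sum_in_mixed_cell)+
qed (rule convex_mixed_cell)

text \<open>Inside a common independent sum, the label of a subcell can be read off from the point set. This is what identifies
  the label that a subdivision assigns to a face.\<close>
lemma mixed_cell_subset_imp_label_subset:
  assumes M: "fine_label n M"
    and A: "face_sequence n A" "\<And>i. i \<in> {1..n} \<Longrightarrow> A i \<subseteq> M i"
    and B: "\<And>i. i \<in> {1..n} \<Longrightarrow> B i \<subseteq> M i"
    and sub: "mixed_cell n A \<subseteq> mixed_cell n B" and k: "k \<in> {1..n}"
  shows "A k \<subseteq> B k"
proof
  fix a assume a: "a \<in> A k"
  have "\<forall>i\<in>{1..n}. \<exists>b. b \<in> A i" using A(1) by (auto simp: face_sequence_def)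
  then obtain e where e: "\<And>i. i \<in> {1..n} \<Longrightarrow> e i \<in> A i" by metis
  define c where "c = e(k := a)"
  have c: "\<And>i. i \<in> {1..n} \<Longrightarrow> c i \<in> A i" using e a by (simp add: c_def)
  have "(\<Sum>i\<in>{1..n}. axis (c i) 1) \<in> mixed_cell n A"
    by (intro sum_in_mixed_cell axis_in_simplex_face c)
  then have "(\<Sum>i\<in>{1..n}. axis (c i) 1) \<in> mixed_cell n B" using sub by blast
  then obtain y where y: "\<And>i. i \<in> {1..n} \<Longrightarrow> y i \<in> simplex_face (B i)"
      "(\<Sum>i\<in>{1..n}. axis (c i) 1) = (\<Sum>i\<in>{1..n}. y i)"
    unfolding mem_mixed_cell by blast
  have "axis (c k) 1 = y k"
  proof (rule fine_label_unique_summands[OF M _ _ y(2) k])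
    fix i assume i: "i \<in> {1..n}"
    show "axis (c i) 1 \<in> simplex_face (M i)" using axis_in_simplex_face c[OF i] A(2)[OF i] by blast
    show "y i \<in> simplex_face (M i)" using y(1)[OF i] simplex_face_mono[OF B[OF i]] by blast
  qed
  then have "axis a 1 \<in> simplex_face (B k)" using y(1)[OF k] by (simp add: c_def)
  then show "a \<in> B k" unfolding mem_simplex_face by (metis axis_nth zero_neq_one)
qed

section \<open>Coordinates of points in a cell\<close>

text \<open>A summand contributes the full mass 1 to the coordinates in \<open>A\<close> if it lies in \<open>A\<close>, and none if it avoids \<open>A\<close>.\<close>
lemma mixed_cell_mass_bounds:
  fixes B :: "nat \<Rightarrow> 'd::finite set"
  assumes "v \<in> mixed_cell n B"
  shows "real (card {i\<in>{1..n}. B i \<subseteq> A}) \<le> (\<Sum>a\<in>A. v $ a)"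
    and "(\<Sum>a\<in>A. v $ a) \<le> real (card {i\<in>{1..n}. B i \<inter> A \<noteq> {}})"
proof -
  obtain x where x: "\<And>i. i \<in> {1..n} \<Longrightarrow> x i \<in> simplex_face (B i)" "v = (\<Sum>i\<in>{1..n}. x i)"
    using assms unfolding mem_mixed_cell by blast
  have mass: "(\<Sum>a\<in>A. v $ a) = (\<Sum>i\<in>{1..n}. \<Sum>a\<in>A. x i $ a)"
    unfolding x(2) by (simp add: sum.swap[of _ A])
  have total: "(\<Sum>a\<in>UNIV. x i $ a) = 1" if "i \<in> {1..n}" for i
    using x(1)[OF that] by (simp add: mem_simplex_face)
  have nonneg: "0 \<le> x i $ a" if "i \<in> {1..n}" for i a
    using x(1)[OF that] by (simp add: mem_simplex_face)
  have "real (card {i\<in>{1..n}. B i \<subseteq> A}) = (\<Sum>i\<in>{1..n}. if B i \<subseteq> A then 1 else 0)"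
    by (simp add: sum.If_cases Int_def)
  also have "\<dots> \<le> (\<Sum>i\<in>{1..n}. \<Sum>a\<in>A. x i $ a)"
  proof (intro sum_mono)
    fix i assume i: "i \<in> {1..n}"
    have "(\<Sum>a\<in>A. x i $ a) = (\<Sum>a\<in>UNIV. x i $ a)" if "B i \<subseteq> A"
      using x(1)[OF i] that by (intro sum.mono_neutral_left) (auto simp: mem_simplex_face)
    then show "(if B i \<subseteq> A then 1 else 0) \<le> (\<Sum>a\<in>A. x i $ a)"
      using total[OF i] by (auto intro: sum_nonneg nonneg[OF i])
  qed
  finally show "real (card {i\<in>{1..n}. B i \<subseteq> A}) \<le> (\<Sum>a\<in>A. v $ a)"
    unfolding mass .
  have "(\<Sum>i\<in>{1..n}. \<Sum>a\<in>A. x i $ a) \<le> (\<Sum>i\<in>{1..n}. if B i \<inter> A \<noteq> {} then 1 else 0)"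
  proof (intro sum_mono)
    fix i assume i: "i \<in> {1..n}"
    have "(\<Sum>a\<in>A. x i $ a) = 0" if "B i \<inter> A = {}"
      using x(1)[OF i] that by (intro sum.neutral) (auto simp: mem_simplex_face)
    moreover have "(\<Sum>a\<in>A. x i $ a) \<le> (\<Sum>a\<in>UNIV. x i $ a)"
      by (intro sum_mono2) (auto intro: nonneg[OF i])
    ultimately show "(\<Sum>a\<in>A. x i $ a) \<le> (if B i \<inter> A \<noteq> {} then 1 else 0)"
      using total[OF i] by auto
  qed
  also have "\<dots> = real (card {i\<in>{1..n}. B i \<inter> A \<noteq> {}})"
    by (simp add: sum.If_cases Int_def)
  finally show "(\<Sum>a\<in>A. v $ a) \<le> real (card {i\<in>{1..n}. B i \<inter> A \<noteq> {}})"
    unfolding mass .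
qed

lemma sum_two_vertices:
  fixes I :: "nat set" and a b :: "'d::finite"
  assumes "finite I" "a \<noteq> b" "\<And>i. i \<in> I \<Longrightarrow> B i = {a} \<or> B i = {b}"
    "\<And>i. i \<in> I \<Longrightarrow> x i \<in> simplex_face (B i)"
  shows "(\<Sum>i\<in>I. x i) = real (card {i\<in>I. B i = {b}}) *\<^sub>R axis b 1 + real (card {i\<in>I. B i = {a}}) *\<^sub>R axis a 1"
proof -
  have "(\<Sum>i\<in>I. x i) = (\<Sum>i\<in>I. if B i = {b} then axis b 1 else axis a 1)"
  proof (intro sum.cong refl)
    fix i assume i: "i \<in> I"
    from assms(3)[OF i] show "x i = (if B i = {b} then axis b 1 else axis a 1)"
    proof
      assume Bi: "B i = {a}"
      then show ?thesis using assms(4)[OF i, unfolded Bi simplex_face_singleton] assms(2) by simp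
    next
      assume Bi: "B i = {b}"
      then show ?thesis using assms(4)[OF i, unfolded Bi simplex_face_singleton] by simp
    qed
  qed
  also have "\<dots> = real (card {i\<in>I. B i = {b}}) *\<^sub>R axis b 1 + real (card {i\<in>I. B i \<noteq> {b}}) *\<^sub>R axis a 1"
    using assms(1) by (simp add: sum.If_cases Int_def Compl_eq sum_constant_scaleR del: sum_constant)
  also have "{i\<in>I. B i \<noteq> {b}} = {i\<in>I. B i = {a}}" using assms(2,3) by auto
  finally show ?thesis .
qed

lemma in_dilated_simplexI:
  fixes v :: "real ^ 'd::finite"
  assumes "n \<ge> 1" "\<And>a. 0 \<le> v $ a" "(\<Sum>a\<in>UNIV. v $ a) = real n"
  shows "v \<in> dilated_simplex n"
  unfolding dilated_simplex_def
proof (rule image_eqI)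
  show "v = real n *\<^sub>R ((1 / real n) *\<^sub>R v)" using assms by simp
  show "(1 / real n) *\<^sub>R v \<in> simplex_face UNIV"
    using assms by (auto simp: mem_simplex_face simp flip: sum_divide_distrib)
qed

section \<open>Occurring labels\<close>

locale fine_subdivision =
  fixes n :: nat and T :: "(real ^ 'd::finite) set set" and lab :: "(real ^ 'd) set \<Rightarrow> nat \<Rightarrow> 'd set"
  assumes n_pos: "n \<ge> 1" and subdivision: "fine_mixed_subdivision n T lab"
begin

lemma covers: "\<Union>T = dilated_simplex n"
  using subdivision unfolding fine_mixed_subdivision_def by (elim conjE)

lemma inter_face_of:
  assumes "C \<in> T" "D \<in> T"
  shows "(C \<inter> D) face_of C" "(C \<inter> D) face_of D"
proof -
  have "\<forall>C\<in>T. \<forall>D\<in>T. (C \<inter> D) face_of C \<and> (C \<inter> D) face_of D"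
    using subdivision unfolding fine_mixed_subdivision_def by (elim conjE)
  then show "(C \<inter> D) face_of C" "(C \<inter> D) face_of D" using assms by auto
qed

lemma fine_label_lab: "C \<in> T \<Longrightarrow> fine_label n (lab C)"
proof -
  have "\<forall>C\<in>T. fine_label n (lab C)"
    using subdivision unfolding fine_mixed_subdivision_def by (elim conjE)
  then show "C \<in> T \<Longrightarrow> fine_label n (lab C)" by (rule bspec)
qed

lemma cell_label:
  assumes "F \<in> cells T"
  shows face_sequence_lab: "face_sequence n (lab F)" and mixed_cell_lab: "mixed_cell n (lab F) = F"
proof -
  have "\<forall>F\<in>cells T. face_sequence n (lab F) \<and> F = mixed_cell n (lab F)"
    using subdivision unfolding fine_mixed_subdivision_def by (elim conjE)
  note this[rule_format, OF assms]
  then show "face_sequence n (lab F)" "mixed_cell n (lab F) = F" by simp_all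
qed

lemma lab_mono:
  assumes "F \<in> cells T" "G \<in> cells T" "F face_of G" "i \<in> {1..n}"
  shows "lab F i \<subseteq> lab G i"
proof -
  have "\<forall>F\<in>cells T. \<forall>G\<in>cells T. F face_of G \<longrightarrow> (\<forall>i\<in>{1..n}. lab F i \<subseteq> lab G i)"
    using subdivision unfolding fine_mixed_subdivision_def by (elim conjE)
  then show ?thesis using assms by blast
qed

lemma maximal_cell_in_cells: "C \<in> T \<Longrightarrow> C \<noteq> {} \<Longrightarrow> C \<in> cells T"
  using inter_face_of[of C C] by (auto simp: cells_def)

lemma finite_maximal_cells: "finite T"
proof (rule finite_subset)
  show "T \<subseteq> insert {} (mixed_cell n ` ({1..n} \<rightarrow>\<^sub>E UNIV))"
  proof
    fix C assume C: "C \<in> T"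
    show "C \<in> insert {} (mixed_cell n ` ({1..n} \<rightarrow>\<^sub>E UNIV))"
    proof (cases "C = {}")
      case False
      have "mixed_cell n (restrict (lab C) {1..n}) = mixed_cell n (lab C)"
        by (intro mixed_cell_cong) auto
      also have "\<dots> = C"
        by (rule mixed_cell_lab[OF maximal_cell_in_cells[OF C False]])
      finally have "C = mixed_cell n (restrict (lab C) {1..n})" by (rule sym)
      moreover have "restrict (lab C) {1..n} \<in> {1..n} \<rightarrow>\<^sub>E UNIV" by auto
      ultimately have "C \<in> mixed_cell n ` ({1..n} \<rightarrow>\<^sub>E UNIV)" by (rule image_eqI)
      then show ?thesis by (rule insertI2)
    qed simp
  qed
  show "finite (insert {} (mixed_cell n ` ({1..n} \<rightarrow>\<^sub>E (UNIV :: 'd set set))))"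
    by (intro finite.insertI finite_imageI finite_PiE) auto
qed

lemma point_in_maximal_cell:
  assumes "\<And>a. 0 \<le> v $ a" "(\<Sum>a\<in>UNIV. v $ a) = real n"
  obtains C where "C \<in> T" "v \<in> C" "C = mixed_cell n (lab C)"
proof -
  have "v \<in> \<Union>T" using in_dilated_simplexI[OF n_pos assms] covers by simp
  then obtain C where "C \<in> T" "v \<in> C" by blast
  moreover from this have "mixed_cell n (lab C) = C"
    by (intro mixed_cell_lab maximal_cell_in_cells) auto
  ultimately show thesis using that by simp
qed

text \<open>The requirement on \<open>lab\<close> matters: the same point set may be the Minkowski sum of several sequences of faces, such as
  permutations of one another, and only one of them is its label.\<close>
definition occurs :: "(nat \<Rightarrow> 'd set) \<Rightarrow> bool" where
  "occurs B \<longleftrightarrow> mixed_cell n B \<in> cells T \<and> (\<forall>i\<in>{1..n}. lab (mixed_cell n B) i = B i)"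

lemma occurs_nonempty: "occurs B \<Longrightarrow> i \<in> {1..n} \<Longrightarrow> B i \<noteq> {}"
  using face_sequence_lab unfolding occurs_def face_sequence_def by metis

lemma occurs_determined_by_cell:
  "occurs A \<Longrightarrow> occurs B \<Longrightarrow> mixed_cell n A = mixed_cell n B \<Longrightarrow> i \<in> {1..n} \<Longrightarrow> A i = B i"
  unfolding occurs_def by metis

text \<open>The sum of the smaller faces is a face of \<open>G\<close>. Its own label lies below that of \<open>G\<close> as well, and two labels below
  an independent one that describe the same set agree.\<close>
lemma occurs_if_below_maximal:
  assumes G: "G \<in> T" "G \<noteq> {}" and B: "face_sequence n B" "\<And>i. i \<in> {1..n} \<Longrightarrow> B i \<subseteq> lab G i"
  shows "occurs B"
proof -
  let ?F = "mixed_cell n B"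
  have Gc: "G \<in> cells T" using G by (rule maximal_cell_in_cells)
  have "?F face_of G"
    using mixed_cell_face_of[OF fine_label_lab[OF G(1)] B(2)] mixed_cell_lab[OF Gc] by simp
  then have F: "?F \<in> cells T"
    using G(1) mixed_cell_nonempty[OF B(1)] by (auto simp: cells_def)
  have L: "\<And>i. i \<in> {1..n} \<Longrightarrow> lab ?F i \<subseteq> lab G i"
    by (rule lab_mono[OF F Gc \<open>?F face_of G\<close>])
  have "lab ?F i = B i" if i: "i \<in> {1..n}" for i
  proof
    show "lab ?F i \<subseteq> B i"
      using mixed_cell_lab[OF F]
      by (intro mixed_cell_subset_imp_label_subset[OF fine_label_lab[OF G(1)] face_sequence_lab[OF F] L B(2) _ i]) auto
    show "B i \<subseteq> lab ?F i"
      using mixed_cell_lab[OF F]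
      by (intro mixed_cell_subset_imp_label_subset[OF fine_label_lab[OF G(1)] B(1) B(2) L _ i]) auto
  qed
  then show ?thesis using F by (simp add: occurs_def)
qed

lemma occurs_subface:
  assumes B: "occurs B" and A: "\<And>i. i \<in> {1..n} \<Longrightarrow> A i \<noteq> {} \<and> A i \<subseteq> B i"
  shows "occurs A"
proof -
  have F: "mixed_cell n B \<in> cells T" using B by (simp add: occurs_def)
  then obtain C where C: "C \<in> T" "mixed_cell n B face_of C" "mixed_cell n B \<noteq> {}"
    by (auto simp: cells_def)
  then have ne: "C \<noteq> {}" using face_of_imp_subset by blast
  show ?thesis
  proof (rule occurs_if_below_maximal[OF C(1) ne])
    show "face_sequence n A" using A by (simp add: face_sequence_def)
    fix i assume i: "i \<in> {1..n}"
    then show "A i \<subseteq> lab C i"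
      using A[OF i] B lab_mono[OF F maximal_cell_in_cells[OF C(1) ne] C(2) i] by (auto simp: occurs_def)
  qed
qed

section \<open>Walking through the subdivision\<close>

text \<open>As \<open>T\<close> is finite, a sequence on the segment from \<open>x\<close> to the vertex that converges to \<open>x\<close> visits some maximal cell
  \<open>G\<close> infinitely often. That cell is closed, hence contains \<open>x\<close>; and a face of the subdivision with a relative
  interior point in \<open>G\<close> is a face of \<open>G\<close>.\<close>
lemma cell_adjacent_towards_vertex:
  assumes B: "occurs B"
  obtains x y G t where "x \<in> mixed_cell n B" "G \<in> T" "y \<in> G" "0 < t"
    "y = x + t *\<^sub>R (real n *\<^sub>R axis a 1 - x)"
    "\<And>i. i \<in> {1..n} \<Longrightarrow> B i \<subseteq> lab G i"
proof -
  let ?F = "mixed_cell n B"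
  have F: "?F \<in> cells T" using B by (simp add: occurs_def)
  then obtain C where C: "C \<in> T" "?F face_of C" "?F \<noteq> {}"
    by (auto simp: cells_def)
  have "rel_interior ?F \<noteq> {}"
    using C(3) convex_mixed_cell rel_interior_eq_empty by blast
  then obtain x where x: "x \<in> rel_interior ?F" by blast
  then have xF: "x \<in> ?F" using rel_interior_subset by blast
  then have xd: "x \<in> dilated_simplex n"
    using C covers face_of_imp_subset by blast
  then obtain x' where x': "x = real n *\<^sub>R x'" "x' \<in> simplex_face UNIV"
    by (auto simp: dilated_simplex_def)
  define t where "t = (\<lambda>m::nat. inverse (real (Suc m)))"
  have t: "0 < t m" "t m \<le> 1" for m by (auto simp: t_def divide_simps)
  define y where "y = (\<lambda>m. x + t m *\<^sub>R (real n *\<^sub>R axis a 1 - x))"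
  have "y m \<in> dilated_simplex n" for m
    unfolding dilated_simplex_def
  proof (rule image_eqI)
    show "y m = real n *\<^sub>R ((1 - t m) *\<^sub>R x' + t m *\<^sub>R axis a 1)"
      by (simp add: y_def x'(1) algebra_simps)
    show "(1 - t m) *\<^sub>R x' + t m *\<^sub>R axis a 1 \<in> simplex_face UNIV"
      using t[of m] x'(2) by (intro convexD[OF convex_simplex_face] axis_in_simplex_face) auto
  qed
  then have "\<forall>m. \<exists>G\<in>T. y m \<in> G" using covers by blast
  then obtain f where f: "\<And>m. f m \<in> T" "\<And>m. y m \<in> f m" by metis
  have "\<exists>m0\<in>UNIV. infinite {m\<in>UNIV. f m = f m0}"
    using f(1) by (intro pigeonhole_infinite finite_subset[OF _ finite_maximal_cells]) auto
  then obtain m0 where inf: "infinite {m. f m = f m0}" by auto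
  define G where "G = f m0"
  have G: "G \<in> T" "y m0 \<in> G" using f by (auto simp: G_def)
  then have Gc: "G \<in> cells T" by (intro maximal_cell_in_cells) auto
  have "closed G" using mixed_cell_lab[OF Gc] closed_mixed_cell by metis
  have lim: "y \<longlonglongrightarrow> x"
  proof -
    have "t \<longlonglongrightarrow> 0" unfolding t_def by (rule LIMSEQ_inverse_real_of_nat)
    then have "y \<longlonglongrightarrow> x + 0 *\<^sub>R (real n *\<^sub>R axis a 1 - x)"
      unfolding y_def by (intro tendsto_intros)
    then show ?thesis by simp
  qed
  have xG: "x \<in> G"
  proof (rule ccontr)
    assume "x \<notin> G"
    then have "eventually (\<lambda>m. y m \<in> - G) sequentially"
      using lim \<open>closed G\<close> by (intro topological_tendstoD) auto
    then obtain N where N: "\<And>m. m \<ge> N \<Longrightarrow> y m \<notin> G" by (auto simp: eventually_sequentially)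
    have "m < N" if "f m = f m0" for m
      using N[of m] f(2)[of m] that by (force simp: G_def not_le[symmetric])
    then have "{m. f m = f m0} \<subseteq> {..<N}" by auto
    then have "finite {m. f m = f m0}" by (rule finite_subset) simp
    then show False using inf by simp
  qed
  have "?F \<subseteq> G \<inter> C"
  proof (rule subset_of_face_of)
    show "G \<inter> C face_of C" using inter_face_of[OF G(1) C(1)] by simp
    show "?F \<subseteq> C" using C(2) by (rule face_of_imp_subset)
    show "(G \<inter> C) \<inter> rel_interior ?F \<noteq> {}"
      using x xG xF face_of_imp_subset[OF C(2)] by blast
  qed
  then have "?F face_of G \<inter> C"
    by (rule face_of_subset[OF C(2)]) simp
  then have FG: "?F face_of G"
    using inter_face_of(1)[OF G(1) C(1)] by (rule face_of_trans)
  have "B i \<subseteq> lab G i" if i: "i \<in> {1..n}" for i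
    using lab_mono[OF F Gc FG i] B i by (simp add: occurs_def)
  then show thesis
    using that[OF xF G t(1)[of m0]] by (simp add: y_def)
qed

text \<open>On the cell of \<open>B\<close> the mass on \<open>A\<close> equals the number of summands inside \<open>A\<close>. It grows strictly on the way to a
  vertex of \<open>A\<close>, so the label of the adjacent cell has more summands meeting \<open>A\<close> than \<open>B\<close> has.\<close>
lemma push_towards:
  assumes B: "occurs B" and split: "\<And>i. i \<in> {1..n} \<Longrightarrow> B i \<subseteq> A \<or> B i \<inter> A = {}"
    and j: "j \<in> {1..n}" "\<not> B j \<subseteq> A" and A: "A \<noteq> {}"
  obtains k z where "k \<in> {1..n}" "z \<in> A" "B k \<inter> A = {}" "occurs (B(k := insert z (B k)))"
proof -
  obtain a where a: "a \<in> A" using A by blast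
  obtain x y G t where x: "x \<in> mixed_cell n B" and G: "G \<in> T" "y \<in> G" and t: "0 < t"
    and y: "y = x + t *\<^sub>R (real n *\<^sub>R axis a 1 - x)"
    and BG: "\<And>i. i \<in> {1..n} \<Longrightarrow> B i \<subseteq> lab G i"
    using cell_adjacent_towards_vertex[OF B, of a] by metis
  have Gc: "G \<in> cells T" using G maximal_cell_in_cells by blast
  let ?P = "{i\<in>{1..n}. B i \<subseteq> A}" and ?Q = "{i\<in>{1..n}. lab G i \<inter> A \<noteq> {}}"
  have same: "{i\<in>{1..n}. B i \<inter> A \<noteq> {}} = ?P"
    using split occurs_nonempty[OF B] by blast
  have mx: "(\<Sum>b\<in>A. x $ b) = real (card ?P)"
    using mixed_cell_mass_bounds[OF x, of A] unfolding same by linarith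
  have "card ?P < card {1..n}" using j by (intro psubset_card_mono) auto
  then have "(\<Sum>b\<in>A. x $ b) < real n" using mx by simp
  moreover have "(\<Sum>b\<in>A. y $ b) = (\<Sum>b\<in>A. x $ b) + t * (real n - (\<Sum>b\<in>A. x $ b))"
  proof -
    have "(\<Sum>b\<in>A. axis a (1::real) $ b) = 1"
      using a by (simp add: axis_def)
    then show ?thesis
      by (simp add: y sum.distrib sum_subtractf flip: sum_distrib_left)
  qed
  ultimately have "real (card ?P) < (\<Sum>b\<in>A. y $ b)" using t mx by simp
  also have "\<dots> \<le> real (card ?Q)"
    using G(2) mixed_cell_lab[OF Gc] by (intro mixed_cell_mass_bounds) simp
  finally have "\<not> ?Q \<subseteq> ?P" using card_mono[of ?P ?Q] by force
  then obtain k where k: "k \<in> {1..n}" "lab G k \<inter> A \<noteq> {}" "\<not> B k \<subseteq> A" by blast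
  then obtain z where z: "z \<in> lab G k" "z \<in> A" by blast
  have "occurs (B(k := insert z (B k)))"
    using BG z G(2) occurs_nonempty[OF B]
    by (intro occurs_if_below_maximal[OF G(1)]) (auto simp: face_sequence_def)
  then show thesis using that k z split[OF k(1)] by blast
qed

text \<open>A Sperner-type statement: starting from the vertex \<open>a + \<dots> + a\<close>, the vertices of \<open>A\<close> are added to the \<open>i\<close>-th
  summand one by one. To add \<open>c\<close>, walk towards \<open>c\<close>; the walk cannot end before \<open>c\<close> enters the \<open>i\<close>-th summand,
  since that summand keeps the mass on \<open>c\<close> below \<open>n\<close>.\<close>
lemma occurs_with_full_summand:
  assumes i: "i \<in> {1..n}" and A: "A \<noteq> {}"
  obtains B where "occurs B" "B i = A" "\<And>k. k \<in> {1..n} \<Longrightarrow> k \<noteq> i \<Longrightarrow> \<exists>a\<in>A. B k = {a}"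
proof -
  have "\<exists>B. occurs B \<and> B i = A \<and> (\<forall>k\<in>{1..n} - {i}. \<exists>a\<in>A. B k = {a})"
    using finite[of A] A
  proof (induction A rule: finite_ne_induct)
    case (singleton a)
    have "0 \<le> (real n *\<^sub>R axis a 1 :: real ^ 'd) $ b" for b
      by (simp add: axis_def)
    moreover have "(\<Sum>b\<in>UNIV. (real n *\<^sub>R axis a 1 :: real ^ 'd) $ b) = real n"
      by (simp add: axis_def flip: sum_distrib_left)
    ultimately obtain C where C: "C \<in> T" "real n *\<^sub>R axis a 1 \<in> C" "C = mixed_cell n (lab C)"
      by (rule point_in_maximal_cell)
    let ?Q = "{k\<in>{1..n}. lab C k \<inter> {a} \<noteq> {}}"
    have "real n *\<^sub>R axis a 1 \<in> mixed_cell n (lab C)" using C by simp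
    from mixed_cell_mass_bounds(2)[OF this, of "{a}"] have "card {1..n} \<le> card ?Q"
      by (simp add: axis_def)
    then have Q: "?Q = {1..n}" by (intro card_seteq) auto
    have "occurs (\<lambda>_. {a})"
    proof (rule occurs_if_below_maximal[OF C(1)])
      fix k assume "k \<in> {1..n}"
      then have "k \<in> ?Q" unfolding Q .
      then show "{a} \<subseteq> lab C k" by simp
    qed (use C(2) in \<open>auto simp: face_sequence_def\<close>)
    then show ?case by auto
  next
    case (insert c A)
    have *: "\<exists>B'. occurs B' \<and> B' i = insert c A \<and> (\<forall>k\<in>{1..n} - {i}. \<exists>a\<in>insert c A. B' k = {a})"
      if "occurs B" "B i = A" "\<forall>k\<in>{1..n} - {i}. \<exists>a\<in>insert c A. B k = {a}" for B
      using that
    proof (induction "card {k\<in>{1..n}. c \<notin> B k}" arbitrary: B rule: less_induct)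
      case less
      have other: "\<exists>a\<in>insert c A. B k = {a}" if "k \<in> {1..n}" "k \<noteq> i" for k
        using less.prems(3) that by blast
      have "B k \<subseteq> {c} \<or> B k \<inter> {c} = {}" if k: "k \<in> {1..n}" for k
        using other[OF k] less.prems(2) insert.hyps by (cases "k = i") auto
      moreover have "\<not> B i \<subseteq> {c}" using less.prems(2) insert.hyps by auto
      ultimately obtain k z where k: "k \<in> {1..n}" "z \<in> {c}" "B k \<inter> {c} = {}"
        and occ: "occurs (B(k := insert z (B k)))"
        using push_towards[OF less.prems(1), of "{c}" i] i by (metis insert_not_empty)
      show ?case
      proof (cases "k = i")
        case True
        show ?thesis
          using occ k(2) less.prems(2,3) True by (intro exI[of _ "B(k := insert z (B k))"]) auto
      next
        case False
        show ?thesis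
        proof (rule less.hyps)
          show "card {l\<in>{1..n}. c \<notin> (B(k := {c})) l} < card {l\<in>{1..n}. c \<notin> B l}"
            using k by (intro psubset_card_mono) auto
          show "occurs (B(k := {c}))"
            using k occurs_nonempty[OF less.prems(1)] by (intro occurs_subface[OF occ]) auto
        qed (use False less.prems in auto)
      qed
    qed
    obtain B where "occurs B" "B i = A" "\<forall>k\<in>{1..n} - {i}. \<exists>a\<in>A. B k = {a}"
      using insert.IH by blast
    then show ?case by (intro *[of B]) auto
  qed
  then obtain B where "occurs B \<and> B i = A \<and> (\<forall>k\<in>{1..n} - {i}. \<exists>a\<in>A. B k = {a})" ..
  then show thesis by (intro that[of B]) auto
qed

text \<open>Walking towards \<open>A\<close> alters only summands that avoid \<open>A\<close>, each of them once. That the other summands keep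
  their values is the point of the lemma.\<close>
lemma occurs_retract:
  assumes "occurs B" "\<And>k. k \<in> {1..n} \<Longrightarrow> B k \<subseteq> A \<or> B k \<inter> A = {}" "A \<noteq> {}"
  shows "\<exists>B'. occurs B' \<and>
    (\<forall>k\<in>{1..n}. if B k \<subseteq> A then B' k = B k else (\<exists>a\<in>A. B' k = {a}))"
  using assms(1,2)
proof (induction "card {k\<in>{1..n}. \<not> B k \<subseteq> A}" arbitrary: B rule: less_induct)
  case less
  show ?case
  proof (cases "\<forall>k\<in>{1..n}. B k \<subseteq> A")
    case True
    then show ?thesis using less.prems(1) by (intro exI[of _ B]) simp
  next
    case False
    then obtain j where "j \<in> {1..n}" "\<not> B j \<subseteq> A" by blast
    then obtain k z where k: "k \<in> {1..n}" "z \<in> A" "B k \<inter> A = {}"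
      and occ: "occurs (B(k := insert z (B k)))"
      using push_towards[OF less.prems(1) less.prems(2)] assms(3) by metis
    have nA: "\<not> B k \<subseteq> A" using k occurs_nonempty[OF less.prems(1) k(1)] by blast
    have "\<exists>B'. occurs B' \<and>
      (\<forall>l\<in>{1..n}. if (B(k := {z})) l \<subseteq> A then B' l = (B(k := {z})) l else (\<exists>a\<in>A. B' l = {a}))"
    proof (rule less.hyps)
      show "card {l\<in>{1..n}. \<not> (B(k := {z})) l \<subseteq> A} < card {l\<in>{1..n}. \<not> B l \<subseteq> A}"
        using k nA by (intro psubset_card_mono) auto
      show "occurs (B(k := {z}))"
        using k occurs_nonempty[OF less.prems(1)] by (intro occurs_subface[OF occ]) auto
      show "(B(k := {z})) l \<subseteq> A \<or> (B(k := {z})) l \<inter> A = {}" if "l \<in> {1..n}" for l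
        using less.prems(2)[OF that] k by simp
    qed
    then obtain B' where B': "occurs B'"
      "\<And>l. l \<in> {1..n} \<Longrightarrow> if (B(k := {z})) l \<subseteq> A then B' l = (B(k := {z})) l else (\<exists>a\<in>A. B' l = {a})"
      by blast
    have "if B l \<subseteq> A then B' l = B l else (\<exists>a\<in>A. B' l = {a})" if l: "l \<in> {1..n}" for l
      using B'(2)[OF l] k(2) nA by (cases "l = k") auto
    then show ?thesis using B'(1) by blast
  qed
qed

section \<open>Cells on an edge of the simplex\<close>

definition edge_label :: "'d \<Rightarrow> 'd \<Rightarrow> nat \<Rightarrow> (nat \<Rightarrow> 'd set) \<Rightarrow> bool" where
  "edge_label a b r B \<longleftrightarrow>
     card {i\<in>{1..n}. B i = {b}} = r - 1 \<and> card {i\<in>{1..n}. B i = {a}} = n - r \<and>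
     card {i\<in>{1..n}. B i = {a, b}} = 1"

lemma edge_labelE:
  assumes "edge_label a b r B" "a \<noteq> b" "r \<in> {1..n}"
  obtains m where "m \<in> {1..n}" "B m = {a, b}" "\<And>i. i \<in> {1..n} \<Longrightarrow> i \<noteq> m \<Longrightarrow> B i = {a} \<or> B i = {b}"
proof -
  let ?K = "\<lambda>S. {i\<in>{1..n}. B i = S}"
  have "card (?K {a, b}) = 1" using assms(1) by (simp add: edge_label_def)
  then obtain m where m: "?K {a, b} = {m}" by (rule card_1_singletonE)
  have "card (?K {b} \<union> ?K {a} \<union> ?K {a, b}) = card (?K {b}) + card (?K {a}) + card (?K {a, b})"
    using assms(2) by (subst card_Un_disjoint; auto)+
  also have "\<dots> = card {1..n}" using assms by (simp add: edge_label_def)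
  finally have all: "?K {b} \<union> ?K {a} \<union> ?K {a, b} = {1..n}"
    by (intro card_subset_eq) auto
  show thesis
  proof (rule that)
    have "m \<in> ?K {a, b}" using m by simp
    then show "m \<in> {1..n}" "B m = {a, b}" by simp_all
    fix i assume i: "i \<in> {1..n}" "i \<noteq> m"
    have "i \<in> ?K {b} \<union> ?K {a} \<union> ?K {a, b}" unfolding all by (rule i(1))
    moreover have "i \<notin> ?K {a, b}" unfolding m using i(2) by simp
    ultimately show "B i = {a} \<or> B i = {b}" using i(1) by blast
  qed
qed

text \<open>The point set depends on the position \<open>r\<close> only, and cells with the same point set have the same label; so the
  cell at position \<open>r\<close> is unique.\<close>
lemma mixed_cell_edge_label:
  fixes B :: "nat \<Rightarrow> 'd set"
  assumes B: "edge_label a b r B" and ab: "a \<noteq> b" and r: "r \<in> {1..n}"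
  shows "mixed_cell n B =
    (+) (real (r - 1) *\<^sub>R axis b 1 + real (n - r) *\<^sub>R axis a 1) ` simplex_face {a, b}"
proof -
  obtain m where m: "m \<in> {1..n}" "B m = {a, b}"
    and other: "\<And>i. i \<in> {1..n} \<Longrightarrow> i \<noteq> m \<Longrightarrow> B i = {a} \<or> B i = {b}"
    using edge_labelE[OF assms] by metis
  have K: "{i\<in>{1..n} - {m}. B i = {b}} = {i\<in>{1..n}. B i = {b}}"
       "{i\<in>{1..n} - {m}. B i = {a}} = {i\<in>{1..n}. B i = {a}}"
    using m ab by auto
  let ?v = "real (r - 1) *\<^sub>R axis b 1 + real (n - r) *\<^sub>R axis a 1 :: real ^ 'd"
  have sum: "(\<Sum>i\<in>{1..n}. x i) = ?v + x m"
    if "\<And>i. i \<in> {1..n} \<Longrightarrow> x i \<in> simplex_face (B i)" for x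
  proof -
    have "(\<Sum>i\<in>{1..n}. x i) = x m + (\<Sum>i\<in>{1..n} - {m}. x i)"
      using m(1) by (intro sum.remove) auto
    also have "(\<Sum>i\<in>{1..n} - {m}. x i)
        = real (card {i\<in>{1..n} - {m}. B i = {b}}) *\<^sub>R axis b 1
          + real (card {i\<in>{1..n} - {m}. B i = {a}}) *\<^sub>R axis a 1"
      using ab that other by (intro sum_two_vertices) auto
    also have "\<dots> = ?v" unfolding K using B by (simp add: edge_label_def)
    finally show ?thesis by (simp add: add.commute)
  qed
  show ?thesis
  proof (intro equalityI subsetI)
    fix p assume "p \<in> mixed_cell n B"
    then obtain x where x: "\<And>i. i \<in> {1..n} \<Longrightarrow> x i \<in> simplex_face (B i)" "p = (\<Sum>i\<in>{1..n}. x i)"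
      unfolding mem_mixed_cell by blast
    then have "p = ?v + x m" using sum by simp
    moreover have "x m \<in> simplex_face {a, b}" using x(1)[OF m(1)] m(2) by simp
    ultimately show "p \<in> (+) ?v ` simplex_face {a, b}" by blast
  next
    fix p assume "p \<in> (+) ?v ` simplex_face {a, b}"
    then obtain q where q: "q \<in> simplex_face {a, b}" "p = ?v + q" by blast
    define x where "x = (\<lambda>i. if i = m then q else if B i = {b} then axis b 1 else axis a 1)"
    have x: "x i \<in> simplex_face (B i)" if "i \<in> {1..n}" for i
      using other[OF that] m q ab by (auto simp: x_def simplex_face_singleton)
    have "p = (\<Sum>i\<in>{1..n}. x i)" using sum[OF x] q by (simp add: x_def)
    then show "p \<in> mixed_cell n B" using sum_in_mixed_cell[of n x B] x by simp
  qed
qed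

lemma edge_cell_eq:
  assumes "occurs B" "edge_label a b r B" "a \<noteq> b" "r \<in> {1..n}"
  shows "edge_cell n T lab a b r = mixed_cell n B"
  unfolding edge_cell_def
proof (rule the_equality)
  have "{i\<in>{1..n}. lab (mixed_cell n B) i = S} = {i\<in>{1..n}. B i = S}" for S
    using assms(1) by (auto simp: occurs_def)
  then show "mixed_cell n B \<in> cells T \<and>
      card {i\<in>{1..n}. lab (mixed_cell n B) i = {b}} = r - 1 \<and>
      card {i\<in>{1..n}. lab (mixed_cell n B) i = {a}} = n - r \<and>
      card {i\<in>{1..n}. lab (mixed_cell n B) i = {a, b}} = 1"
    using assms(1,2) by (simp only: edge_label_def occurs_def)
next
  fix F assume F: "F \<in> cells T \<and> card {i\<in>{1..n}. lab F i = {b}} = r - 1 \<and>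
      card {i\<in>{1..n}. lab F i = {a}} = n - r \<and> card {i\<in>{1..n}. lab F i = {a, b}} = 1"
  then have "edge_label a b r (lab F)" by (simp add: edge_label_def)
  then have "mixed_cell n (lab F) = mixed_cell n B"
    using mixed_cell_edge_label assms by metis
  then show "F = mixed_cell n B" using mixed_cell_lab F by metis
qed

lemma subdivision_perm_eq:
  assumes "occurs B" "edge_label a b r B" "a \<noteq> b" "r \<in> {1..n}" "m \<in> {1..n}" "B m = {a, b}"
  shows "subdivision_perm n T lab a b r = m"
proof -
  have lab: "lab (edge_cell n T lab a b r) i = B i" if "i \<in> {1..n}" for i
    using edge_cell_eq[OF assms(1-4)] assms(1) that by (simp add: occurs_def)
  have "card {i\<in>{1..n}. B i = {a, b}} = 1" using assms(2) by (simp add: edge_label_def)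
  then obtain m' where m': "{i\<in>{1..n}. B i = {a, b}} = {m'}" by (rule card_1_singletonE)
  have "(THE i. i \<in> {1..n} \<and> lab (edge_cell n T lab a b r) i = {a, b}) = m"
  proof (rule the_equality)
    fix i assume "i \<in> {1..n} \<and> lab (edge_cell n T lab a b r) i = {a, b}"
    then have "i \<in> {i\<in>{1..n}. B i = {a, b}}" using lab by force
    moreover have "m \<in> {i\<in>{1..n}. B i = {a, b}}" using assms(5,6) by simp
    ultimately show "i = m" unfolding m' by simp
  qed (use assms(5,6) lab[OF assms(5)] in simp)
  then show ?thesis using assms(4) by (simp add: subdivision_perm_def)
qed

text \<open>Consider a maximal cell containing the midpoint of the \<open>r\<close>-th unit segment, and its face on the edge. Two summands
  equal to \<open>{a, b}\<close> would violate independence, since their vertices could be exchanged without changing the sum;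
  none at all would make the \<open>b\<close>-coordinate of the midpoint, \<open>r - 1/2\<close>, an integer.\<close>
lemma edge_label_occurs:
  assumes ab: "a \<noteq> b" and r: "r \<in> {1..n}"
  shows "\<exists>B. occurs B \<and> edge_label a b r B"
proof -
  define v :: "real ^ 'd"
    where "v = (real n - real r + 1 / 2) *\<^sub>R axis a 1 + (real r - 1 / 2) *\<^sub>R axis b 1"
  have v: "v $ c = (if c = a then real n - real r + 1 / 2 else if c = b then real r - 1 / 2 else 0)" for c
    using ab by (auto simp: v_def axis_def)
  have nonneg: "0 \<le> v $ c" for c using r unfolding v by auto
  have "(\<Sum>c\<in>UNIV. v $ c) = (\<Sum>c\<in>{a, b}. v $ c)"
    by (intro sum.mono_neutral_right) (auto simp: v)
  also have "\<dots> = real n" using ab by (simp add: v)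
  finally obtain C where C: "C \<in> T" "v \<in> C" "C = mixed_cell n (lab C)"
    using point_in_maximal_cell[OF nonneg] by metis
  then have "v \<in> mixed_cell n (lab C)" by simp
  then obtain x where x: "\<And>i. i \<in> {1..n} \<Longrightarrow> x i \<in> simplex_face (lab C i)" "v = (\<Sum>i\<in>{1..n}. x i)"
    unfolding mem_mixed_cell by blast
  define B where "B = (\<lambda>i. lab C i \<inter> {a, b})"
  have xB: "x i \<in> simplex_face (B i)" if i: "i \<in> {1..n}" for i
  proof -
    have "x i $ c = 0" if c: "c \<notin> {a, b}" for c
    proof -
      have "(\<Sum>i\<in>{1..n}. x i $ c) = 0" using c v[of c] unfolding x(2) by simp
      moreover have "\<And>i. i \<in> {1..n} \<Longrightarrow> 0 \<le> x i $ c" using x(1) by (simp add: mem_simplex_face)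
      ultimately show ?thesis using i sum_nonneg_eq_0_iff[of "{1..n}" "\<lambda>i. x i $ c"] by blast
    qed
    then show ?thesis using x(1)[OF i] by (auto simp: mem_simplex_face B_def)
  qed
  have Bne: "B i \<noteq> {}" if "i \<in> {1..n}" for i
    using xB[OF that] by (auto simp: simplex_face_def)
  have occ: "occurs B"
    using C(2) Bne by (intro occurs_if_below_maximal[OF C(1)]) (auto simp: face_sequence_def B_def)
  have Bcases: "B i = {a} \<or> B i = {b} \<or> B i = {a, b}" if "i \<in> {1..n}" for i
    using Bne[OF that] by (auto simp: B_def)
  have vB: "v \<in> mixed_cell n B" unfolding x(2) by (rule sum_in_mixed_cell[OF xB])
  let ?K = "\<lambda>S. {i\<in>{1..n}. B i = S}"
  have below: "{i\<in>{1..n}. B i \<subseteq> {b}} = ?K {b}" using Bne by blast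
  have above: "{i\<in>{1..n}. B i \<inter> {b} \<noteq> {}} = ?K {b} \<union> ?K {a, b}" using Bcases ab by blast
  have "real (card (?K {b})) \<le> v $ b"
    using mixed_cell_mass_bounds(1)[OF vB, of "{b}"] unfolding below by simp
  then have le: "real (card (?K {b})) \<le> real r - 1 / 2" using ab by (simp add: v)
  have "v $ b \<le> real (card (?K {b} \<union> ?K {a, b}))"
    using mixed_cell_mass_bounds(2)[OF vB, of "{b}"] unfolding above by simp
  also have "\<dots> = real (card (?K {b})) + real (card (?K {a, b}))"
    using ab by (subst card_Un_disjoint) auto
  finally have ge: "real r - 1 / 2 \<le> real (card (?K {b})) + real (card (?K {a, b}))"
    using ab by (simp add: v)
  have unique: "k = l" if kl: "k \<in> ?K {a, b}" "l \<in> ?K {a, b}" for k l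
  proof (rule ccontr)
    assume neq: "k \<noteq> l"
    have "\<forall>i\<in>{1..n}. \<exists>c. c \<in> B i" using Bne by blast
    then obtain e where e: "\<And>i. i \<in> {1..n} \<Longrightarrow> e i \<in> B i" by metis
    \<comment> \<open>The vertex of the cell with \<open>p\<close> and \<open>q\<close> in the places \<open>k\<close> and \<open>l\<close>.\<close>
    let ?x = "\<lambda>p q i. axis ((e(k := p, l := q)) i) 1 :: real ^ 'd"
    have sum: "(\<Sum>i\<in>{1..n}. ?x p q i) = axis p 1 + (axis q 1 + (\<Sum>i\<in>{1..n} - {k} - {l}. axis (e i) 1))" for p q
    proof -
      have "(\<Sum>i\<in>{1..n}. ?x p q i) = ?x p q k + (\<Sum>i\<in>{1..n} - {k}. ?x p q i)"
        using kl by (intro sum.remove) auto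
      also have "(\<Sum>i\<in>{1..n} - {k}. ?x p q i) = ?x p q l + (\<Sum>i\<in>{1..n} - {k} - {l}. ?x p q i)"
        using kl neq by (intro sum.remove) auto
      also have "(\<Sum>i\<in>{1..n} - {k} - {l}. ?x p q i) = (\<Sum>i\<in>{1..n} - {k} - {l}. axis (e i) 1)"
        by (intro sum.cong) auto
      also have "?x p q k = axis p 1" using neq by simp
      also have "?x p q l = axis q 1" by simp
      finally show ?thesis .
    qed
    have face: "?x p q i \<in> simplex_face (lab C i)" if "i \<in> {1..n}" "p \<in> {a, b}" "q \<in> {a, b}" for p q i
    proof (rule axis_in_simplex_face)
      show "(e(k := p, l := q)) i \<in> lab C i"
        using e[OF that(1)] kl that(2,3) by (auto simp: B_def)
    qed
    have "?x a b k = ?x b a k"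
    proof (rule fine_label_unique_summands[OF fine_label_lab[OF C(1)], where x = "?x a b" and y = "?x b a"])
      show "(\<Sum>i\<in>{1..n}. ?x a b i) = (\<Sum>i\<in>{1..n}. ?x b a i)" unfolding sum by simp
    qed (use kl face in auto)
    then show False using neq ab by (simp add: axis_eq_axis)
  qed
  have "card (?K {a, b}) \<le> 1"
    using unique by (intro card_le_Suc0_iff_eq[THEN iffD2, unfolded One_nat_def[symmetric]]) auto
  moreover have "card (?K {b}) < r"
    using le by linarith
  moreover from this have "card (?K {b}) + card (?K {a, b}) \<ge> r"
    using ge by linarith
  ultimately have cards: "card (?K {a, b}) = 1" "card (?K {b}) = r - 1" by linarith+
  have "card (?K {b} \<union> ?K {a} \<union> ?K {a, b}) = card (?K {b}) + card (?K {a}) + card (?K {a, b})"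
    using ab by (subst card_Un_disjoint; auto)+
  moreover have "?K {b} \<union> ?K {a} \<union> ?K {a, b} = {1..n}" using Bcases by blast
  ultimately have "card (?K {a}) = n - r" using cards r by auto
  then show ?thesis using occ cards by (auto simp: edge_label_def)
qed


lemma edge_labelI:
  assumes ab: "a \<noteq> b" and m: "m \<in> {1..n}" "B m = {a, b}"
    and other: "\<And>k. k \<in> {1..n} \<Longrightarrow> k \<noteq> m \<Longrightarrow> B k = {a} \<or> B k = {b}"
  obtains r where "r \<in> {1..n}" "edge_label a b r B"
proof -
  let ?K = "\<lambda>S. {i\<in>{1..n}. B i = S}"
  have Kab: "?K {a, b} = {m}"
  proof (intro equalityI subsetI)
    fix k assume k: "k \<in> ?K {a, b}"
    then show "k \<in> {m}" using other[of k] ab by (cases "k = m") auto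
  qed (use m in simp)
  have all: "?K {b} \<union> ?K {a} \<union> ?K {a, b} = {1..n}"
    using other m by blast
  have "card (?K {b} \<union> ?K {a} \<union> ?K {a, b}) = card (?K {b}) + card (?K {a}) + card (?K {a, b})"
    using ab by (subst card_Un_disjoint; auto)+
  then have n: "n = card (?K {b}) + card (?K {a}) + 1"
    unfolding all unfolding Kab by simp
  show thesis
  proof (rule that)
    show "Suc (card (?K {b})) \<in> {1..n}" using n by simp
    show "edge_label a b (Suc (card (?K {b}))) B"
      unfolding edge_label_def Kab using n by simp
  qed
qed

lemma edge_label_swap: "r \<in> {1..n} \<Longrightarrow> edge_label a b r B \<Longrightarrow> edge_label b a (n + 1 - r) B"
  by (auto simp: edge_label_def insert_commute)

lemma subdivision_perm_reverse:
  assumes ab: "a \<noteq> b" and r: "r \<in> {1..n}"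
  shows "subdivision_perm n T lab a b r = subdivision_perm n T lab b a (n + 1 - r)"
proof -
  obtain B where B: "occurs B" "edge_label a b r B" using edge_label_occurs[OF assms] by blast
  obtain m where m: "m \<in> {1..n}" "B m = {a, b}" using edge_labelE[OF B(2) assms] by metis
  have "subdivision_perm n T lab a b r = m"
    by (rule subdivision_perm_eq[OF B ab r m])
  moreover have "subdivision_perm n T lab b a (n + 1 - r) = m"
    using ab r m by (intro subdivision_perm_eq[OF B(1) edge_label_swap[OF r B(2)]]) auto
  ultimately show ?thesis by simp
qed

text \<open>The retraction of a cell onto the edge between \<open>a\<close> and \<open>b\<close>. The \<open>i\<close>-th summand determines its position, and the
  summands already equal to \<open>a\<close> or \<open>b\<close> tell which indices moved before \<open>i\<close> and which ones move later.\<close>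
lemma edge_label_with_given_summands:
  assumes B: "occurs B" "i \<in> {1..n}" "B i = {a, b}" "a \<noteq> b"
    and other: "\<And>k. k \<in> {1..n} \<Longrightarrow> k \<noteq> i \<Longrightarrow> \<exists>c. B k = {c}"
  obtains r B' where "r \<in> {1..n}" "occurs B'" "edge_label a b r B'"
    "subdivision_perm n T lab a b r = i"
    "\<And>k. k \<in> {1..n} \<Longrightarrow> B k \<subseteq> {a, b} \<Longrightarrow> B' k = B k"
proof -
  have "B k \<subseteq> {a, b} \<or> B k \<inter> {a, b} = {}" if "k \<in> {1..n}" for k
    using other[OF that] B(3) by (cases "k = i") auto
  then obtain B' where B': "occurs B'"
    "\<And>k. k \<in> {1..n} \<Longrightarrow> if B k \<subseteq> {a, b} then B' k = B k else (\<exists>c\<in>{a, b}. B' k = {c})"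
    using occurs_retract[OF B(1), of "{a, b}"] by blast
  have i: "B' i = {a, b}" using B'(2)[OF B(2)] B(3) by simp
  have single: "B' k = {a} \<or> B' k = {b}" if k: "k \<in> {1..n}" "k \<noteq> i" for k
    using B'(2)[OF k(1)] other[OF k] by (auto split: if_splits)
  obtain r where r: "r \<in> {1..n}" "edge_label a b r B'"
    using edge_labelI[where B = B' and a = a and b = b, OF B(4) B(2) i single] by blast
  show thesis
    using that[OF r(1) B'(1) r(2)] subdivision_perm_eq[OF B'(1) r(2) B(4) r(1) B(2) i] B'(2) by auto
qed

lemma subdivision_perm_in:
  assumes "a \<noteq> b" "r \<in> {1..n}"
  shows "subdivision_perm n T lab a b r \<in> {1..n}"
proof -
  obtain B where B: "occurs B" "edge_label a b r B" using edge_label_occurs[OF assms] by blast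
  obtain m where m: "m \<in> {1..n}" "B m = {a, b}" using edge_labelE[OF B(2) assms] by metis
  then show ?thesis using subdivision_perm_eq[OF B assms m] by simp
qed

text \<open>Surjectivity suffices by finiteness, and it holds because some cell has \<open>{a, b}\<close> as its \<open>i\<close>-th summand and can be
  retracted onto the edge.\<close>
lemma subdivision_perm_bij:
  assumes ab: "a \<noteq> b"
  shows "bij_betw (subdivision_perm n T lab a b) {1..n} {1..n}"
proof -
  let ?s = "subdivision_perm n T lab a b"
  have "i \<in> ?s ` {1..n}" if i: "i \<in> {1..n}" for i
  proof -
    obtain B where B: "occurs B" "B i = UNIV" "\<And>k. k \<in> {1..n} \<Longrightarrow> k \<noteq> i \<Longrightarrow> \<exists>c\<in>UNIV. B k = {c}"
      using occurs_with_full_summand[OF i UNIV_not_empty] by metis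
    let ?B = "B(i := {a, b})"
    have occ: "occurs ?B"
      using B(2) occurs_nonempty[OF B(1)] by (intro occurs_subface[OF B(1)]) auto
    have Bi: "?B i = {a, b}" by simp
    have single: "\<exists>c. ?B k = {c}" if "k \<in> {1..n}" "k \<noteq> i" for k
      using B(3)[OF that] that(2) by auto
    obtain r where "r \<in> {1..n}" "?s r = i"
      using edge_label_with_given_summands[OF occ i Bi ab single] by metis
    then show ?thesis by blast
  qed
  then have "?s ` {1..n} = {1..n}" using subdivision_perm_in[OF ab] by blast
  then show ?thesis
    unfolding bij_betw_def using finite_surj_inj[of "{1..n}" ?s] by simp
qed

text \<open>By induction on \<open>r\<close>: the end of one segment and the start of the next are the same vertex cell, so replacing the
  moving summand of the former by \<open>b\<close> and that of the latter by \<open>a\<close> gives the same label.\<close>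
lemma summands_equal_to_endpoint:
  assumes ab: "a \<noteq> b"
  shows "r \<in> {1..n} \<Longrightarrow> occurs B \<Longrightarrow> edge_label a b r B \<Longrightarrow>
    {k\<in>{1..n}. B k = {b}} = subdivision_perm n T lab a b ` {1..<r}"
proof (induction r arbitrary: B)
  case (Suc s)
  let ?s = "subdivision_perm n T lab a b"
  show ?case
  proof (cases "s = 0")
    case True
    then have "card {k\<in>{1..n}. B k = {b}} = 0" using Suc.prems(3) by (simp add: edge_label_def)
    then show ?thesis using True by simp
  next
    case False
    then have s: "s \<in> {1..n}" using Suc.prems(1) by simp
    obtain A where A: "occurs A" "edge_label a b s A" using edge_label_occurs[OF ab s] by blast
    obtain p where p: "p \<in> {1..n}" "A p = {a, b}" "\<And>k. k \<in> {1..n} \<Longrightarrow> k \<noteq> p \<Longrightarrow> A k = {a} \<or> A k = {b}"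
      using edge_labelE[OF A(2) ab s] by metis
    obtain q where q: "q \<in> {1..n}" "B q = {a, b}" "\<And>k. k \<in> {1..n} \<Longrightarrow> k \<noteq> q \<Longrightarrow> B k = {a} \<or> B k = {b}"
      using edge_labelE[OF Suc.prems(3) ab Suc.prems(1)] by metis
    have sp: "?s s = p" by (rule subdivision_perm_eq[OF A ab s p(1,2)])
    \<comment> \<open>Both \<open>A'\<close> and \<open>B'\<close> label the vertex shared by the segments \<open>s\<close> and \<open>s + 1\<close>.\<close>
    define A' where "A' = A(p := {b})"
    define B' where "B' = B(q := {a})"
    have oA: "occurs A'"
      unfolding A'_def using p occurs_nonempty[OF A(1)] by (intro occurs_subface[OF A(1)]) auto
    have oB: "occurs B'"
      unfolding B'_def using q occurs_nonempty[OF Suc.prems(2)]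
      by (intro occurs_subface[OF Suc.prems(2)]) auto
    have A'b: "{k\<in>{1..n}. A' k = {b}} = insert p {k\<in>{1..n}. A k = {b}}"
      and B'b: "{k\<in>{1..n}. B' k = {b}} = {k\<in>{1..n}. B k = {b}}"
      and A'a: "{k\<in>{1..n}. A' k = {a}} = {k\<in>{1..n}. A k = {a}}"
      and B'a: "{k\<in>{1..n}. B' k = {a}} = insert q {k\<in>{1..n}. B k = {a}}"
      using p(1,2) q(1,2) ab by (auto simp: A'_def B'_def)
    have cards: "card {k\<in>{1..n}. A' k = {b}} = s" "card {k\<in>{1..n}. B' k = {b}} = s"
        "card {k\<in>{1..n}. A' k = {a}} = n - s" "card {k\<in>{1..n}. B' k = {a}} = n - s"
      unfolding A'b B'b A'a B'a
      using A(2) Suc.prems(1,3) p(2) q(2) ab s by (auto simp: edge_label_def)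
    have A'cases: "A' k = {a} \<or> A' k = {b}" and B'cases: "B' k = {a} \<or> B' k = {b}"
      if "k \<in> {1..n}" for k
      using p(3)[OF that] q(3)[OF that] by (auto simp: A'_def B'_def)
    let ?v = "real s *\<^sub>R axis b 1 + real (n - s) *\<^sub>R axis a 1 :: real ^ 'd"
    have point: "mixed_cell n D = {?v}"
      if D: "occurs D" "\<And>k. k \<in> {1..n} \<Longrightarrow> D k = {a} \<or> D k = {b}"
        "card {k\<in>{1..n}. D k = {b}} = s" "card {k\<in>{1..n}. D k = {a}} = n - s" for D
    proof -
      have "v = ?v" if v: "v \<in> mixed_cell n D" for v
      proof -
        obtain x where x: "\<And>i. i \<in> {1..n} \<Longrightarrow> x i \<in> simplex_face (D i)" "v = (\<Sum>i\<in>{1..n}. x i)"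
          using v unfolding mem_mixed_cell by blast
        show ?thesis
          using sum_two_vertices[where B = D and x = x and I = "{1..n}", OF finite_atLeastAtMost ab D(2) x(1)] 
          unfolding x(2) D(3,4) .
      qed
      moreover have "mixed_cell n D \<noteq> {}" using D(1) by (simp add: occurs_def cells_def)
      ultimately show ?thesis by blast
    qed
    have "mixed_cell n A' = mixed_cell n B'"
      using point[OF oA A'cases cards(1,3)] point[OF oB B'cases cards(2,4)] by simp
    then have "A' k = B' k" if "k \<in> {1..n}" for k
      using occurs_determined_by_cell[OF oA oB _ that] by simp
    then have "{k\<in>{1..n}. B' k = {b}} = {k\<in>{1..n}. A' k = {b}}" by auto
    then have "{k\<in>{1..n}. B k = {b}} = insert p (?s ` {1..<s})"
      unfolding A'b B'b Suc.IH[OF s A] .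
    also have "\<dots> = ?s ` {1..<Suc s}"
      using s sp by (simp add: atLeastLessThanSuc)
    finally show ?thesis .
  qed
qed simp

section \<open>Acyclicity\<close>

text \<open>Well-foundedness gives acyclicity without handling cycles: only one vertex of \<open>Q\<close> without predecessor in
  \<open>Q\<close> has to be found, and the \<open>j\<close>-th summand of a cell with \<open>i\<close>-th summand \<open>Q\<close> is such a vertex.\<close>
lemma wf_edge_digraph:
  assumes i: "i \<in> {1..n}" and j: "j \<in> {1..n}" and ij: "i \<noteq> j"
  shows "wf (edge_digraph n (subdivision_perm n T lab) i j)"
  unfolding wf_eq_minimal
proof (intro allI impI)
  fix Q :: "'d set" and x assume "x \<in> Q"
  then have "Q \<noteq> {}" by blast
  then obtain B where B: "occurs B" "B i = Q" "\<And>k. k \<in> {1..n} \<Longrightarrow> k \<noteq> i \<Longrightarrow> \<exists>c\<in>Q. B k = {c}"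
    using occurs_with_full_summand[OF i] by metis
  obtain p where p: "p \<in> Q" "B j = {p}" using B(3)[OF j] ij by blast
  show "\<exists>z\<in>Q. \<forall>q. (q, z) \<in> edge_digraph n (subdivision_perm n T lab) i j \<longrightarrow> q \<notin> Q"
  proof (rule bexI[OF _ p(1)], intro allI impI notI)
    fix q assume "(q, p) \<in> edge_digraph n (subdivision_perm n T lab) i j" and q: "q \<in> Q"
    then have qp: "q \<noteq> p" and before: "appears_before n (subdivision_perm n T lab q p) i j"
      by (auto simp: edge_digraph_def)
    let ?s = "subdivision_perm n T lab q p"
    have inj: "inj_on ?s {1..n}" using subdivision_perm_bij[OF qp] by (simp add: bij_betw_def)
    let ?B = "B(i := {q, p})"
    have occ: "occurs ?B"
      using B(2) p(1) q occurs_nonempty[OF B(1)] by (intro occurs_subface[OF B(1)]) auto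
    have Bi: "?B i = {q, p}" by simp
    have single: "\<exists>c. ?B k = {c}" if "k \<in> {1..n}" "k \<noteq> i" for k
      using B(3)[OF that] that(2) by auto
    obtain r B' where r: "r \<in> {1..n}" "occurs B'" "edge_label q p r B'" "?s r = i"
      "\<And>k. k \<in> {1..n} \<Longrightarrow> ?B k \<subseteq> {q, p} \<Longrightarrow> B' k = ?B k"
      using edge_label_with_given_summands[OF occ i Bi qp single] by metis
    \<comment> \<open>At the segment where \<open>i\<close> moves, \<open>j\<close> has arrived at \<open>p\<close> already.\<close>
    have "B' j = {p}" using r(5)[OF j] p(2) ij by simp
    then have "j \<in> ?s ` {1..<r}"
      using summands_equal_to_endpoint[OF qp r(1,2,3)] j by blast
    then obtain t where t: "t \<in> {1..<r}" "?s t = j" by blast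
    obtain r' s where rs: "r' \<in> {1..n}" "s \<in> {1..n}" "r' < s" "?s r' = i" "?s s = j"
      using before by (auto simp: appears_before_def)
    have "r' = r" using inj_onD[OF inj] rs r by metis
    moreover have "t \<in> {1..n}" using t(1) r(1) by simp
    then have "s = t" using inj_onD[OF inj] rs t by metis
    ultimately show False using rs t by simp
  qed
qed

lemma acyclic_system_subdivision_perm: "acyclic_system n (subdivision_perm n T lab)"
  unfolding acyclic_system_def system_of_permutations_def
proof (intro conjI allI impI ballI)
  fix a b :: 'd assume ab: "a \<noteq> b"
  show "subdivision_perm n T lab a b permutes {1..n}"
  proof (rule bij_imp_permutes[OF subdivision_perm_bij[OF ab]])
    fix r assume "r \<notin> {1..n}"
    then show "subdivision_perm n T lab a b r = r" by (simp only: subdivision_perm_def if_False)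
  qed
  show "subdivision_perm n T lab a b r = subdivision_perm n T lab b a (n + 1 - r)" if "r \<in> {1..n}" for r
    using subdivision_perm_reverse[OF ab that] .
next
  fix i j assume "i \<in> {1..n}" "j \<in> {1..n}" "i \<noteq> j"
  then show "acyclic (edge_digraph n (subdivision_perm n T lab) i j)"
    by (intro wf_acyclic wf_edge_digraph)
qed

end

theorem theorem5p6:
  fixes n :: nat
    and T :: "(real ^ 'd::finite) set set"
    and lab :: "(real ^ 'd) set \<Rightarrow> nat \<Rightarrow> 'd set"
  assumes "n \<ge> 1"
    and "fine_mixed_subdivision n T lab"
  shows "acyclic_system n (subdivision_perm n T lab)"
proof -
  interpret fine_subdivision n T lab using assms by unfold_locales
  show ?thesis by (rule acyclic_system_subdivision_perm)
qed

end
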